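(* Let $\lambda\ge 0$ be a real number. Let $\Omega_\lambda=\{x\in\mathbb{R}^2:\ \|x\|<1/\lambda\}$ if $\lambda>0$ and $\Omega_0=\mathbb{R}^2$. Then the $\lambda$-Funk metric $F:\Omega_\lambda\times\mathbb{R}^2\to\mathbb{R}$, $$F(x,y)=\frac{\sqrt{\lambda^2\langle x,y\rangle^2+\|y\|^2(1-\lambda^2\|x\|^2)}}{1-\lambda^2\|x\|^2}+\frac{\lambda\langle x,y\rangle}{1-\lambda^2\|x\|^2},$$ is projectively flat on $\Omega_\lambda$.
   Context: $\langle\cdot,\cdot\rangle$ and $\|\cdot\|$ denote the usual Euclidean inner product and norm. A Finsler metric on an open set $U\subset\mathbb{R}^n$ is a function $F:U\times\mathbb{R}^n\to\mathbb{R}$ such that: (1) $F(x,y)$ is $C^\infty$ for all $x\in U$ and $y\ne 0$; (2) $F(x,y)>0$ for all $x\in U$ and $y\neq 0$; (3) $F(x,\delta y)=\delta F(x,y)$ for every $\delta>0$; (4) the Hessian matrix $\left[\frac12\frac{\partial^2F^2}{\partial y_i\partial y_j}\right]$ is positive definite (for $y\ne0$). The function $F$ in the claim is a Finsler metric on $\Omega_\lambda$. A Finsler metric $F$ on an open subset $U\subset\mathbb{R}^n$ is said to be projectively flat if all its geodesics are straight lines in $U$ (that is, as point sets, geodesics are contained in straight lines; geodesics are understood in the usual sense of Finsler geometry). *)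

theory Defs
  imports "HOL-Analysis.Analysis"
begin

text \<open>Classical $C^k$ and $C^\infty$ regularity; meant for open sets only, since the derivatives
  are the unrestricted ones.\<close>

primrec Ck_on :: "nat \<Rightarrow> 'a::euclidean_space set \<Rightarrow> ('a \<Rightarrow> real) \<Rightarrow> bool" where
  "Ck_on 0 S f \<longleftrightarrow> continuous_on S f"
| "Ck_on (Suc k) S f \<longleftrightarrow>
     (\<forall>x\<in>S. f differentiable (at x)) \<and>
     (\<forall>v\<in>Basis. Ck_on k S (\<lambda>x. frechet_derivative f (at x) v))"

definition smooth_on :: "'a::euclidean_space set \<Rightarrow> ('a \<Rightarrow> real) \<Rightarrow> bool" where
  "smooth_on S f \<longleftrightarrow> (\<forall>k. Ck_on k S f)"

definition partial_deriv :: "'n \<Rightarrow> (real^'n \<Rightarrow> real) \<Rightarrow> real^'n \<Rightarrow> real" where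
  "partial_deriv i f y = frechet_derivative f (at y) (axis i 1)"

definition positive_definite :: "real^'n^'n \<Rightarrow> bool" where
  "positive_definite A \<longleftrightarrow> transpose A = A \<and> (\<forall>v. v \<noteq> 0 \<longrightarrow> v \<bullet> (A *v v) > 0)"

definition fundamental_tensor :: "(real^'n \<Rightarrow> real^'n \<Rightarrow> real) \<Rightarrow> real^'n \<Rightarrow> real^'n \<Rightarrow> real^'n^'n"
  where "fundamental_tensor F x y =
    (\<chi> i j. 1/2 * partial_deriv i (partial_deriv j (\<lambda>z. (F x z)\<^sup>2)) y)"

definition finsler_metric :: "(real^'n) set \<Rightarrow> (real^'n \<Rightarrow> real^'n \<Rightarrow> real) \<Rightarrow> bool" where
  "finsler_metric U F \<longleftrightarrow>
     open U \<and>
     smooth_on (U \<times> (- {0})) (\<lambda>(x, y). F x y) \<and>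
     (\<forall>x\<in>U. \<forall>y. y \<noteq> 0 \<longrightarrow> F x y > 0) \<and>
     (\<forall>x\<in>U. \<forall>y. \<forall>\<delta>>0. F x (\<delta> *\<^sub>R y) = \<delta> * F x y) \<and>
     (\<forall>x\<in>U. \<forall>y. y \<noteq> 0 \<longrightarrow> positive_definite (fundamental_tensor F x y))"

text \<open>$C^\infty$ curves on a nondegenerate interval that need not be open: \<open>d k\<close> is the \<open>k\<close>-th
  derivative, one-sided at endpoints belonging to \<open>I\<close>.\<close>

definition smooth_curve_on :: "real set \<Rightarrow> (real \<Rightarrow> 'a::real_normed_vector) \<Rightarrow> bool" where
  "smooth_curve_on I c \<longleftrightarrow>
     (\<exists>d :: nat \<Rightarrow> real \<Rightarrow> 'a. d 0 = c \<and>
        (\<forall>k. \<forall>t\<in>I. (d k has_vector_derivative d (Suc k) t) (at t within I)))"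

definition finsler_length ::
  "(real^'n \<Rightarrow> real^'n \<Rightarrow> real) \<Rightarrow> real \<Rightarrow> real \<Rightarrow> (real \<Rightarrow> real^'n) \<Rightarrow> real" where
  "finsler_length F a b c =
     integral {a..b} (\<lambda>t. F (c t) (vector_derivative c (at t within {a..b})))"

text \<open>Geodesics are the regular curves that are critical for arc length, on every compact
  subinterval, under variations with fixed endpoints. No parametrization is imposed, so the
  constant-speed geodesics are included. As \<open>U\<close> is an open subset of a vector space, it
  suffices to vary along \<open>c + s \<eta>\<close>: for small \<open>s\<close> these curves stay in \<open>U\<close> and remain
  regular, and every variation field \<open>\<eta>\<close> vanishing at the endpoints arises in this way.\<close>

definition finsler_geodesic ::
  "(real^'n) set \<Rightarrow> (real^'n \<Rightarrow> real^'n \<Rightarrow> real) \<Rightarrow> real set \<Rightarrow> (real \<Rightarrow> real^'n) \<Rightarrow> bool" where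
  "finsler_geodesic U F I c \<longleftrightarrow>
     is_interval I \<and> interior I \<noteq> {} \<and>
     smooth_curve_on I c \<and> c ` I \<subseteq> U \<and>
     (\<forall>t\<in>I. vector_derivative c (at t within I) \<noteq> 0) \<and>
     (\<forall>a b. a < b \<and> {a..b} \<subseteq> I \<longrightarrow>
        (\<forall>\<eta>. smooth_curve_on {a..b} \<eta> \<and> \<eta> a = 0 \<and> \<eta> b = 0 \<longrightarrow>
           ((\<lambda>s. finsler_length F a b (\<lambda>t. c t + s *\<^sub>R \<eta> t)) has_real_derivative 0) (at 0)))"

definition straight_line :: "'a::real_vector set \<Rightarrow> bool" where
  "straight_line L \<longleftrightarrow> (\<exists>p v. v \<noteq> 0 \<and> L = {p + s *\<^sub>R v | s. True})"

definition projectively_flat :: "(real^'n) set \<Rightarrow> (real^'n \<Rightarrow> real^'n \<Rightarrow> real) \<Rightarrow> bool" where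
  "projectively_flat U F \<longleftrightarrow>
     finsler_metric U F \<and>
     (\<forall>I c. finsler_geodesic U F I c \<longrightarrow> (\<exists>L. straight_line L \<and> c ` I \<subseteq> L))"

definition funk_domain :: "real \<Rightarrow> (real^2) set" where
  "funk_domain l = (if l > 0 then {x. norm x < 1 / l} else UNIV)"

definition funk_metric :: "real \<Rightarrow> real^2 \<Rightarrow> real^2 \<Rightarrow> real" where
  "funk_metric l x y =
     sqrt (l\<^sup>2 * (x \<bullet> y)\<^sup>2 + (norm y)\<^sup>2 * (1 - l\<^sup>2 * (norm x)\<^sup>2)) / (1 - l\<^sup>2 * (norm x)\<^sup>2)
     + l * (x \<bullet> y) / (1 - l\<^sup>2 * (norm x)\<^sup>2)"

end

theory Submission imports Defs begin

text \<open>Write \<open>J\<close> for the rotation by a right angle and put \<open>D = 1 - l\<^sup>2 |x|\<^sup>2\<close> and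
\<open>R\<^sup>2 = |y|\<^sup>2 - l\<^sup>2 (Jx \<bullet> y)\<^sup>2\<close>. In the plane the metric becomes \<open>F = R / D + l (x \<bullet> y) / D\<close>:
for \<open>l > 0\<close> a multiple of the Klein metric of the hyperbolic plane plus an exact one-form, namely the
differential of \<open>- ln D / (2 l)\<close>. The exact form does not affect which curves are critical, and Klein
geodesics are chords.

What makes this computable is one identity. Let \<open>p = F\<^sub>y\<close> be the momentum and \<open>f = F\<^sub>x\<close> the
force. When \<open>x\<close> moves with velocity \<open>\<sigma> y\<close> and \<open>y\<close> with velocity \<open>z\<close>,
the momentum changes at the rate
\<open>\<sigma> f + ((Jy \<bullet> z) / R\<^sup>3) Jy\<close> (\<open>has_derivative_momentum\<close>). The first
term is Hamel's equation \<open>F\<^sub>x\<^sub>y y = F\<^sub>x\<close>, which characterises projective flatness; the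
second says that the Hessian of \<open>F\<close> in \<open>y\<close> is \<open>(Jy) (Jy)\<^sup>T / R\<^sup>3\<close>.
The identity is used three times.

With \<open>\<sigma> = 0\<close> it gives the fundamental tensor
\<open>p p\<^sup>T + (F / R\<^sup>3) (Jy) (Jy)\<^sup>T\<close>; this is positive definite, because a vector
orthogonal to \<open>Jy\<close> is a multiple of \<open>y\<close>, and \<open>p \<bullet> y = F > 0\<close>.

With \<open>\<sigma> = 1\<close> along a curve \<open>c\<close> it turns the first variation, after integration by parts, into
\<open>- \<integral> (Jc' \<bullet> c'') (Jc' \<bullet> \<eta>) / R\<^sup>3\<close> (\<open>funk_first_variation\<close>). If \<open>Jc' \<bullet> c''\<close> did not
vanish at a point, a fixed vector times a parabola on a short interval around that point would give
a nonzero first variation (\<open>funk_geodesic_acceleration_parallel\<close>). So along a geodesic the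
acceleration is parallel to the velocity.

With \<open>l = 0\<close> the momentum is the unit tangent \<open>c' / |c'|\<close> and the force vanishes. The other
term vanishes too once acceleration and velocity are parallel, so the unit tangent is constant (\<open>straight_if_acceleration_parallel\<close>).\<close>

section \<open>Rotation by a right angle\<close>

definition rot90 :: "real^2 \<Rightarrow> real^2" where
  "rot90 x = vector [- x $ 2, x $ 1]"

lemma rot90_nth [simp]: "rot90 x $ 1 = - x $ 2" "rot90 x $ 2 = x $ 1"
  by (simp_all add: rot90_def)

lemma inner_real2: "x \<bullet> y = x $ 1 * y $ 1 + x $ 2 * y $ 2" for x y :: "real^2"
  by (simp add: inner_vec_def sum_2)

lemma vec_eq_iff_2: "x = y \<longleftrightarrow> x $ 1 = y $ 1 \<and> x $ 2 = y $ 2" for x y :: "real^2"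
  by (simp add: vec_eq_iff forall_2)

lemma bounded_linear_rot90: "bounded_linear rot90"
  by (auto simp: linear_iff vec_eq_iff_2 intro!: linear_conv_bounded_linear[THEN iffD1])

lemmas has_derivative_rot90 [derivative_intros] = bounded_linear.has_derivative[OF bounded_linear_rot90]
lemmas continuous_on_rot90 [continuous_intros] = bounded_linear.continuous_on[OF bounded_linear_rot90]

lemma rot90_inner: "rot90 x \<bullet> y = x $ 1 * y $ 2 - x $ 2 * y $ 1"
  by (simp add: inner_real2)

lemma parallel_if_rot90_orthogonal:
  fixes u v :: "real^2"
  assumes "u \<noteq> 0" "rot90 u \<bullet> v = 0"
  shows "v = ((u \<bullet> v) / (u \<bullet> u)) *\<^sub>R u"
proof -
  have "(u \<bullet> u) *\<^sub>R v = (u \<bullet> v) *\<^sub>R u"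
    using assms(2) by (simp add: vec_eq_iff_2 inner_real2) algebra
  then have "((u \<bullet> v) / (u \<bullet> u)) *\<^sub>R u = (1 / (u \<bullet> u)) *\<^sub>R ((u \<bullet> u) *\<^sub>R v)" by simp
  also have "\<dots> = v" using assms(1) by simp
  finally show ?thesis by simp
qed

section \<open>The Funk metric and its first derivatives\<close>

text \<open>For \<open>l > 0\<close> the quotient of \<open>klein_root\<close> by \<open>klein_factor\<close> is \<open>1 / l\<close> times the Klein metric of the
disc of radius \<open>1 / l\<close>. Its radicand is written with the cross product \<open>rot90 x \<bullet> y\<close>, because
that product does not change when \<open>x\<close> moves along \<open>y\<close>.\<close>

definition klein_factor :: "real \<Rightarrow> real^2 \<Rightarrow> real" where
  "klein_factor l x = 1 - l\<^sup>2 * (x \<bullet> x)"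

definition klein_root :: "real \<Rightarrow> real^2 \<Rightarrow> real^2 \<Rightarrow> real" where
  "klein_root l x y = sqrt (y \<bullet> y - l\<^sup>2 * (rot90 x \<bullet> y)\<^sup>2)"

text \<open>Lagrange's identity \<open>|x|\<^sup>2 |y|\<^sup>2 = (x \<bullet> y)\<^sup>2 + (Jx \<bullet> y)\<^sup>2\<close>.\<close>

lemma radicand_eq:
  "l\<^sup>2 * (x \<bullet> y)\<^sup>2 + (norm y)\<^sup>2 * (1 - l\<^sup>2 * (norm x)\<^sup>2) = y \<bullet> y - l\<^sup>2 * (rot90 x \<bullet> y)\<^sup>2"
  for x y :: "real^2"
  unfolding power2_norm_eq_inner by (simp add: inner_real2 power2_eq_square algebra_simps)

lemma funk_metric_eq:
  "funk_metric l x y = klein_root l x y / klein_factor l x + l * (x \<bullet> y) / klein_factor l x"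
  unfolding funk_metric_def radicand_eq by (simp add: klein_root_def klein_factor_def power2_norm_eq_inner)

lemma radicand_pos:
  assumes "klein_factor l x > 0" "y \<noteq> 0"
  shows "y \<bullet> y - l\<^sup>2 * (rot90 x \<bullet> y)\<^sup>2 > 0"
proof -
  have "(norm y)\<^sup>2 * (1 - l\<^sup>2 * (norm x)\<^sup>2) > 0"
    using assms by (simp add: klein_factor_def power2_norm_eq_inner)
  then have "l\<^sup>2 * (x \<bullet> y)\<^sup>2 + (norm y)\<^sup>2 * (1 - l\<^sup>2 * (norm x)\<^sup>2) > 0"
    by (simp add: add_nonneg_pos)
  then show ?thesis by (simp only: radicand_eq)
qed

lemma klein_root_pos: "klein_factor l x > 0 \<Longrightarrow> y \<noteq> 0 \<Longrightarrow> klein_root l x y > 0"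
  using radicand_pos by (simp add: klein_root_def)

lemma funk_domain_eq:
  assumes "l \<ge> 0"
  shows "funk_domain l = {x. klein_factor l x > 0}"
proof (cases "l = 0")
  case False
  then have l: "l > 0" using assms by simp
  have "norm x < 1 / l \<longleftrightarrow> l\<^sup>2 * (norm x)\<^sup>2 < 1" for x :: "real^2"
  proof -
    have "norm x < 1 / l \<longleftrightarrow> l * norm x < 1" using l by (simp add: field_simps)
    also have "\<dots> \<longleftrightarrow> (l * norm x)\<^sup>2 < 1\<^sup>2"
      using l abs_square_less_1[of "l * norm x"] by (simp add: abs_mult)
    finally show ?thesis by (simp add: power_mult_distrib)
  qed
  then show ?thesis using l
    by (simp add: funk_domain_def klein_factor_def power2_norm_eq_inner)
qed (simp add: funk_domain_def klein_factor_def)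

text \<open>The square root dominates the linear term since its radicand exceeds \<open>l\<^sup>2 (x \<bullet> y)\<^sup>2\<close> by the
positive number \<open>|y|\<^sup>2 D\<close>.\<close>

lemma funk_metric_pos:
  assumes "klein_factor l x > 0" "y \<noteq> 0"
  shows "funk_metric l x y > 0"
proof -
  have "(l * (x \<bullet> y))\<^sup>2 < y \<bullet> y - l\<^sup>2 * (rot90 x \<bullet> y)\<^sup>2"
    unfolding radicand_eq[symmetric]
    using assms by (simp add: klein_factor_def power2_norm_eq_inner power_mult_distrib)
  then have "\<bar>l * (x \<bullet> y)\<bar> < klein_root l x y"
    unfolding klein_root_def by (metis real_sqrt_abs real_sqrt_less_iff)
  then have "klein_root l x y + l * (x \<bullet> y) > 0" by linarith
  then show ?thesis using assms(1)
    by (simp add: funk_metric_eq flip: add_divide_distrib)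
qed

lemma funk_metric_homogeneous:
  assumes "\<delta> > 0"
  shows "funk_metric l x (\<delta> *\<^sub>R y) = \<delta> * funk_metric l x y"
proof -
  have "(\<delta> *\<^sub>R y) \<bullet> (\<delta> *\<^sub>R y) - l\<^sup>2 * (rot90 x \<bullet> (\<delta> *\<^sub>R y))\<^sup>2
      = \<delta>\<^sup>2 * (y \<bullet> y - l\<^sup>2 * (rot90 x \<bullet> y)\<^sup>2)"
    by (simp add: power2_eq_square algebra_simps)
  then have "klein_root l x (\<delta> *\<^sub>R y) = \<delta> * klein_root l x y"
    unfolding klein_root_def using assms by (simp only: real_sqrt_mult real_sqrt_abs abs_of_pos)
  then show ?thesis by (simp add: funk_metric_eq algebra_simps add_divide_distrib)
qed

text \<open>The partial gradients of the Funk metric, in \<open>y\<close> and in \<open>x\<close> respectively; see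
\<open>has_derivative_funk_metric\<close>.\<close>

definition momentum :: "real \<Rightarrow> real^2 \<Rightarrow> real^2 \<Rightarrow> real^2" where
  "momentum l x y =
     (1 / (klein_root l x y * klein_factor l x)) *\<^sub>R (y - (l\<^sup>2 * (rot90 x \<bullet> y)) *\<^sub>R rot90 x)
     + (l / klein_factor l x) *\<^sub>R x"

definition force :: "real \<Rightarrow> real^2 \<Rightarrow> real^2 \<Rightarrow> real^2" where
  "force l x y =
     (l\<^sup>2 * (rot90 x \<bullet> y) / (klein_root l x y * klein_factor l x)) *\<^sub>R rot90 y
     + (l / klein_factor l x) *\<^sub>R y
     + (2 * l\<^sup>2 * funk_metric l x y / klein_factor l x) *\<^sub>R x"

lemma has_derivative_klein_factor:
  assumes "(x has_derivative x') (at t within S)"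
  shows "((\<lambda>t. klein_factor l (x t)) has_derivative (\<lambda>h. - 2 * l\<^sup>2 * (x t \<bullet> x' h))) (at t within S)"
  unfolding klein_factor_def using assms
  by (auto intro!: derivative_eq_intros simp: inner_commute)

lemma has_derivative_klein_root:
  assumes "(x has_derivative x') (at t within S)" "(y has_derivative y') (at t within S)"
    and "klein_factor l (x t) > 0" "y t \<noteq> 0"
  shows "((\<lambda>t. klein_root l (x t) (y t)) has_derivative
    (\<lambda>h. (y t \<bullet> y' h - l\<^sup>2 * (rot90 (x t) \<bullet> y t) * (rot90 (x' h) \<bullet> y t + rot90 (x t) \<bullet> y' h))
          / klein_root l (x t) (y t))) (at t within S)"
  unfolding klein_root_def using radicand_pos[OF assms(3,4)] assms(1,2)
  by (auto intro!: derivative_eq_intros simp: inner_commute field_simps)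

lemma has_derivative_funk_metric:
  assumes x: "(x has_derivative x') (at t within S)" and y: "(y has_derivative y') (at t within S)"
    and pos: "klein_factor l (x t) > 0" "y t \<noteq> 0"
  shows "((\<lambda>t. funk_metric l (x t) (y t)) has_derivative
    (\<lambda>h. force l (x t) (y t) \<bullet> x' h + momentum l (x t) (y t) \<bullet> y' h)) (at t within S)"
proof -
  define R D m where "R = klein_root l (x t) (y t)" and "D = klein_factor l (x t)"
    and "m = rot90 (x t) \<bullet> y t"
  have R: "R > 0" and D: "D > 0"
    using klein_root_pos pos by (auto simp: R_def D_def)
  have "((\<lambda>t. funk_metric l (x t) (y t)) has_derivative
    (\<lambda>h. (((y t \<bullet> y' h - l\<^sup>2 * m * (rot90 (x' h) \<bullet> y t + rot90 (x t) \<bullet> y' h)) / R) * D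
            - R * (- 2 * l\<^sup>2 * (x t \<bullet> x' h))) / (D * D)
        + (l * (x t \<bullet> y' h + x' h \<bullet> y t) * D - l * (x t \<bullet> y t) * (- 2 * l\<^sup>2 * (x t \<bullet> x' h))) / (D * D)))
      (at t within S)" (is "(_ has_derivative ?d) _")
    unfolding funk_metric_eq R_def D_def m_def
    using has_derivative_klein_root[OF x y pos] has_derivative_klein_factor[OF x] pos
    by (intro has_derivative_add has_derivative_divide' has_derivative_mult_right has_derivative_inner x y) auto
  moreover have "?d h = force l (x t) (y t) \<bullet> x' h + momentum l (x t) (y t) \<bullet> y' h" for h
  proof -
    have rr: "rot90 (x' h) \<bullet> y t = - (rot90 (y t) \<bullet> x' h)" by (simp add: inner_real2)
    have 1: "force l (x t) (y t) \<bullet> x' h = l\<^sup>2 * m / (R * D) * (rot90 (y t) \<bullet> x' h) + l / D * (y t \<bullet> x' h)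
       + 2 * l\<^sup>2 * (R / D + l * (x t \<bullet> y t) / D) / D * (x t \<bullet> x' h)"
      by (simp add: force_def funk_metric_eq R_def D_def m_def inner_add_left)
    have 2: "momentum l (x t) (y t) \<bullet> y' h
      = 1 / (R * D) * (y t \<bullet> y' h - l\<^sup>2 * m * (rot90 (x t) \<bullet> y' h)) + l / D * (x t \<bullet> y' h)"
      by (simp add: momentum_def R_def D_def m_def inner_add_left inner_diff_left)
    show ?thesis
      unfolding 1 2 rr using R D
      by (simp add: field_simps power2_eq_square inner_commute)
  qed
  ultimately show ?thesis by simp
qed

text \<open>Hamel's equation and the Hessian of the metric in one formula. The velocity of the base point is
restricted to multiples of \<open>y\<close>: in this direction the mixed second derivative reduces to the force.
The parameter ranges over a normed space, so that the statement covers both curves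
(\<open>\<sigma> h = h\<close>) and derivatives in \<open>y\<close> at a fixed base point (\<open>\<sigma> = 0\<close>).
The proof collects the terms that come from the movement of \<open>y\<close> and those that come from the
movement of \<open>x\<close>; each group reduces to a polynomial identity modulo the definition of
\<open>R\<^sup>2\<close>.\<close>

lemma has_derivative_momentum:
  assumes x: "(x has_derivative (\<lambda>h. \<sigma> h *\<^sub>R y t)) (at t within S)"
    and y: "(y has_derivative y') (at t within S)"
    and pos: "klein_factor l (x t) > 0" "y t \<noteq> 0"
  shows "((\<lambda>t. momentum l (x t) (y t)) has_derivative
    (\<lambda>h. \<sigma> h *\<^sub>R force l (x t) (y t)
       + ((rot90 (y t) \<bullet> y' h) / klein_root l (x t) (y t) ^ 3) *\<^sub>R rot90 (y t))) (at t within S)"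
proof -
  define X Y R D m where "X = x t" and "Y = y t" and "R = klein_root l (x t) (y t)"
    and "D = klein_factor l (x t)" and "m = rot90 X \<bullet> Y"
  have R: "R > 0" and D: "D > 0"
    using klein_root_pos pos by (auto simp: R_def D_def)
  have R2: "R\<^sup>2 = Y \<bullet> Y - l\<^sup>2 * m\<^sup>2"
    using radicand_pos[OF pos] by (simp add: R_def klein_root_def X_def Y_def m_def)
  have D_eq: "D = 1 - l\<^sup>2 * (X \<bullet> X)" by (simp add: D_def X_def klein_factor_def)
  define n where "n h = (Y \<bullet> y' h - l\<^sup>2 * m * (rot90 X \<bullet> y' h)) / R" for h
  define P where "P = Y - (l\<^sup>2 * m) *\<^sub>R rot90 X"
  have yy: "rot90 Y \<bullet> Y = 0" for Y by (simp add: inner_real2)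
  have sc: "rot90 (a *\<^sub>R v) = a *\<^sub>R rot90 v" for a v by (simp add: vec_eq_iff_2)
  have R': "((\<lambda>t. klein_root l (x t) (y t)) has_derivative n) (at t within S)"
    using has_derivative_klein_root[OF x y pos]
    by (rule has_derivative_eq_rhs)
       (auto simp: n_def[abs_def] R_def Y_def X_def m_def sc yy)
  have D': "((\<lambda>t. klein_factor l (x t)) has_derivative (\<lambda>h. - 2 * l\<^sup>2 * \<sigma> h * (X \<bullet> Y))) (at t within S)"
    using has_derivative_klein_factor[OF x, of l] by (simp add: X_def Y_def mult.assoc)
  have P': "((\<lambda>t. y t - (l\<^sup>2 * (rot90 (x t) \<bullet> y t)) *\<^sub>R rot90 (x t)) has_derivative
     (\<lambda>h. y' h - ((l\<^sup>2 * m) *\<^sub>R (\<sigma> h *\<^sub>R rot90 Y) + (l\<^sup>2 * (rot90 X \<bullet> y' h)) *\<^sub>R rot90 X))) (at t within S)"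
    by (rule derivative_eq_intros x y refl)+ (simp add: X_def Y_def m_def sc yy fun_eq_iff)
  have Dp: "((\<lambda>t. 1 / (klein_root l (x t) (y t) * klein_factor l (x t))) has_derivative
     (\<lambda>h. - (n h / (R\<^sup>2 * D)) + 2 * l\<^sup>2 * \<sigma> h * (X \<bullet> Y) / (R * D\<^sup>2))) (at t within S)"
    apply (rule derivative_eq_intros R' D' refl)+
    using R D apply (simp_all add: R_def[symmetric] D_def[symmetric] field_simps power2_eq_square)
    done
  have Dl: "((\<lambda>t. l / klein_factor l (x t)) has_derivative
     (\<lambda>h. 2 * l^3 * \<sigma> h * (X \<bullet> Y) / D\<^sup>2)) (at t within S)"
    apply (rule derivative_eq_intros D' refl)+
    using D apply (simp_all add: D_def[symmetric] field_simps power2_eq_square power3_eq_cube)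
    done
  have "((\<lambda>t. momentum l (x t) (y t)) has_derivative
    (\<lambda>h. ((1 / (R * D)) *\<^sub>R (y' h - ((l\<^sup>2 * m) *\<^sub>R (\<sigma> h *\<^sub>R rot90 Y) + (l\<^sup>2 * (rot90 X \<bullet> y' h)) *\<^sub>R rot90 X))
        + (- (n h / (R\<^sup>2 * D)) + 2 * l\<^sup>2 * \<sigma> h * (X \<bullet> Y) / (R * D\<^sup>2)) *\<^sub>R P)
      + ((l / D) *\<^sub>R (\<sigma> h *\<^sub>R Y) + (2 * l^3 * \<sigma> h * (X \<bullet> Y) / D\<^sup>2) *\<^sub>R X)))
      (at t within S)" (is "(_ has_derivative ?d) _")
    unfolding momentum_def using has_derivative_add[OF has_derivative_scaleR[OF Dp P'] has_derivative_scaleR[OF Dl x]]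
    by (simp add: R_def D_def P_def X_def Y_def m_def)
  moreover have "?d h = \<sigma> h *\<^sub>R force l X Y + ((rot90 Y \<bullet> y' h) / R ^ 3) *\<^sub>R rot90 Y" for h
  proof -
    \<comment> \<open>The contribution of the movement of \<open>y\<close>, cleared of denominators.\<close>
    have hess: "R\<^sup>2 *\<^sub>R (y' h - (l\<^sup>2 * (rot90 X \<bullet> y' h)) *\<^sub>R rot90 X) - (Y \<bullet> y' h - l\<^sup>2 * m * (rot90 X \<bullet> y' h)) *\<^sub>R P
       = (D * (rot90 Y \<bullet> y' h)) *\<^sub>R rot90 Y"
      unfolding R2 D_eq P_def m_def by (simp add: vec_eq_iff_2 inner_real2 power2_eq_square) algebra
    \<comment> \<open>The identity to which Hamel's equation reduces; it carries the contribution of the movement of \<open>x\<close>.\<close>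
    have hamel: "(X \<bullet> Y) *\<^sub>R P = (m * D) *\<^sub>R rot90 Y + R\<^sup>2 *\<^sub>R X"
      unfolding R2 D_eq P_def m_def by (simp add: vec_eq_iff_2 inner_real2 power2_eq_square) algebra
    have 1: "(1 / (R * D)) *\<^sub>R (y' h - (l\<^sup>2 * (rot90 X \<bullet> y' h)) *\<^sub>R rot90 X) - (n h / (R\<^sup>2 * D)) *\<^sub>R P
       = ((rot90 Y \<bullet> y' h) / R ^ 3) *\<^sub>R rot90 Y"
    proof -
      have "(1 / (R * D)) *\<^sub>R (y' h - (l\<^sup>2 * (rot90 X \<bullet> y' h)) *\<^sub>R rot90 X) - (n h / (R\<^sup>2 * D)) *\<^sub>R P
         = (1 / (R^3 * D)) *\<^sub>R (R\<^sup>2 *\<^sub>R (y' h - (l\<^sup>2 * (rot90 X \<bullet> y' h)) *\<^sub>R rot90 X)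
               - (Y \<bullet> y' h - l\<^sup>2 * m * (rot90 X \<bullet> y' h)) *\<^sub>R P)"
        using R by (simp add: n_def scaleR_diff_right power2_eq_square power3_eq_cube mult_ac)
      then show ?thesis unfolding hess using D by simp
    qed
    have 2: "(2 * l\<^sup>2 * \<sigma> h * (X \<bullet> Y) / (R * D\<^sup>2)) *\<^sub>R P - (\<sigma> h * l\<^sup>2 * m / (R * D)) *\<^sub>R rot90 Y
       = (\<sigma> h * (l\<^sup>2 * m / (R * D))) *\<^sub>R rot90 Y + (\<sigma> h * 2 * l\<^sup>2 * R / D\<^sup>2) *\<^sub>R X"
    proof -
      have "(2 * l\<^sup>2 * \<sigma> h * (X \<bullet> Y) / (R * D\<^sup>2)) *\<^sub>R P = (2 * l\<^sup>2 * \<sigma> h / (R * D\<^sup>2)) *\<^sub>R ((X \<bullet> Y) *\<^sub>R P)"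
        by simp
      also have "\<dots> = (2 * \<sigma> h * l\<^sup>2 * m / (R * D)) *\<^sub>R rot90 Y + (\<sigma> h * 2 * l\<^sup>2 * R / D\<^sup>2) *\<^sub>R X"
        unfolding hamel using R D by (simp add: scaleR_add_right power2_eq_square mult_ac)
      finally show ?thesis by (simp add: vec_eq_iff_2 mult_ac)
    qed
    have F: "force l X Y = (l\<^sup>2 * m / (R * D)) *\<^sub>R rot90 Y + (l / D) *\<^sub>R Y
        + (2 * l\<^sup>2 * R / D\<^sup>2) *\<^sub>R X + (2 * l^3 * (X \<bullet> Y) / D\<^sup>2) *\<^sub>R X"
      using D by (simp add: force_def funk_metric_eq R_def D_def m_def X_def Y_def vec_eq_iff_2 add_divide_distrib
        power2_eq_square power3_eq_cube algebra_simps)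
    show ?thesis
      using 1 2 unfolding F by (simp add: vec_eq_iff_2 algebra_simps)
  qed
  ultimately show ?thesis by (simp add: X_def Y_def R_def)
qed

section \<open>Calculus of $C^k$ functions\<close>

lemma Ck_on_cong:
  assumes "open S" "\<And>x. x \<in> S \<Longrightarrow> f x = g x" "Ck_on k S f"
  shows "Ck_on k S g"
  using assms(2,3)
proof (induction k arbitrary: f g)
  case 0
  then show ?case using continuous_on_cong[of S S f g] by simp
next
  case (Suc k)
  have "f differentiable (at x)" if "x \<in> S" for x
    using Suc.prems(2) that by simp
  then have D: "(g has_derivative frechet_derivative f (at x)) (at x)" if "x \<in> S" for x
    using has_derivative_transform_within_open[OF _ assms(1) that Suc.prems(1)] that
    by (simp add: frechet_derivative_works)
  have "frechet_derivative f (at x) = frechet_derivative g (at x)" if "x \<in> S" for x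
    by (rule frechet_derivative_at[OF D[OF that]])
  then have "Ck_on k S (\<lambda>x. frechet_derivative g (at x) v)" if "v \<in> Basis" for v
    using Suc.prems(2) that by (intro Suc.IH[of "\<lambda>x. frechet_derivative f (at x) v" "\<lambda>x. frechet_derivative g (at x) v"]) auto
  then show ?case using D by (auto simp: differentiable_def)
qed

text \<open>Any derivative found by hand may replace \<open>frechet_derivative\<close>; the inductions below rest
on this.\<close>

lemma Ck_on_SucI:
  assumes "open S" "\<And>x. x \<in> S \<Longrightarrow> (f has_derivative f' x) (at x)"
    and "\<And>v. v \<in> Basis \<Longrightarrow> Ck_on k S (\<lambda>x. f' x v)"
  shows "Ck_on (Suc k) S f"
proof -
  have "f' x = frechet_derivative f (at x)" if "x \<in> S" for x
    using assms(2)[OF that] by (rule frechet_derivative_at)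
  then have "Ck_on k S (\<lambda>x. frechet_derivative f (at x) v)" if "v \<in> Basis" for v
    using that by (intro Ck_on_cong[OF assms(1) _ assms(3)]) auto
  then show ?thesis using assms(2) by (auto simp: differentiable_def)
qed

lemma Ck_on_SucE:
  assumes "Ck_on (Suc k) S f" "x \<in> S"
  shows "(f has_derivative frechet_derivative f (at x)) (at x)"
  using assms by (simp add: frechet_derivative_works)

lemma Ck_on_SucD: "Ck_on (Suc k) S f \<Longrightarrow> Ck_on k S f"
proof (induction k arbitrary: f)
  case 0
  then show ?case
    by (auto intro!: differentiable_imp_continuous_on simp: differentiable_on_def differentiable_at_withinI)
next
  case (Suc k)
  then show ?case by auto
qed

lemma Ck_on_const: "open S \<Longrightarrow> Ck_on k S (\<lambda>x. c)"
proof (induction k arbitrary: c)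
  case (Suc k)
  then show ?case by (intro Ck_on_SucI[where f' = "\<lambda>_ _. 0"]) auto
qed simp

lemma Ck_on_bounded_linear:
  assumes "open S" "bounded_linear f"
  shows "Ck_on k S f"
proof (cases k)
  case 0
  then show ?thesis using assms(2) by (simp add: linear_continuous_on)
next
  case (Suc j)
  show ?thesis
    unfolding Suc using assms
    by (intro Ck_on_SucI[where f' = "\<lambda>_. f"] Ck_on_const bounded_linear_imp_has_derivative)
qed

lemma Ck_on_add:
  "open S \<Longrightarrow> Ck_on k S f \<Longrightarrow> Ck_on k S g \<Longrightarrow> Ck_on k S (\<lambda>x. f x + g x)"
proof (induction k arbitrary: f g)
  case (Suc k)
  show ?case
    by (rule Ck_on_SucI[OF Suc.prems(1) has_derivative_add[OF Ck_on_SucE[OF Suc.prems(2)] Ck_on_SucE[OF Suc.prems(3)]]])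
       (use Suc in auto)
qed (simp add: continuous_on_add)

lemma Ck_on_mult:
  "open S \<Longrightarrow> Ck_on k S f \<Longrightarrow> Ck_on k S g \<Longrightarrow> Ck_on k S (\<lambda>x. f x * g x)"
proof (induction k arbitrary: f g)
  case (Suc k)
  have C: "Ck_on k S f" "Ck_on k S g" using Suc.prems(2,3) by (blast dest: Ck_on_SucD)+
  show ?case
    by (intro Ck_on_SucI[OF Suc.prems(1) has_derivative_mult[OF Ck_on_SucE[OF Suc.prems(2)] Ck_on_SucE[OF Suc.prems(3)]]]
        Ck_on_add Suc.IH C) (use Suc.prems in auto)
qed (simp add: continuous_on_mult)

text \<open>Real powers are closed under differentiation up to a factor, so a single induction with varying
exponent yields square roots and reciprocals together.\<close>

lemma Ck_on_powr:
  "open S \<Longrightarrow> Ck_on k S f \<Longrightarrow> (\<And>x. x \<in> S \<Longrightarrow> f x > 0) \<Longrightarrow> Ck_on k S (\<lambda>x. f x powr a)"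
proof (induction k arbitrary: a)
  case 0
  have "\<forall>x\<in>S. f x \<noteq> 0" using "0.prems"(3) by force
  then show ?case using "0.prems"(2) by (auto intro!: continuous_on_powr continuous_on_const)
next
  case (Suc k)
  have D: "((\<lambda>x. f x powr a) has_derivative
      (\<lambda>h. a * f x powr (a - 1) * frechet_derivative f (at x) h)) (at x)" if "x \<in> S" for x
    using has_derivative_powr[OF Ck_on_SucE[OF Suc.prems(2) that] has_derivative_const[of a] Suc.prems(3)[OF that]]
      Suc.prems(3)[OF that]
    by (auto simp: powr_diff mult_ac elim!: has_derivative_eq_rhs)
  have C: "Ck_on k S f" using Suc.prems(2) by (rule Ck_on_SucD)
  show ?case
    by (intro Ck_on_SucI[OF Suc.prems(1) D] Ck_on_mult Ck_on_const Suc.IH C) (use Suc.prems in auto)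
qed

lemma Ck_on_diff:
  assumes "open S" "Ck_on k S f" "Ck_on k S g"
  shows "Ck_on k S (\<lambda>x. f x - g x)"
  using Ck_on_add[OF assms(1,2) Ck_on_mult[OF assms(1) Ck_on_const[OF assms(1), of k "-1"] assms(3)]] by simp

section \<open>The Funk metric is a Finsler metric\<close>

text \<open>The metric is a polynomial in the coordinates and in the powers of two positive polynomials, with
exponents \<open>1/2\<close> and \<open>-1\<close>.\<close>

lemma smooth_on_funk_metric:
  assumes U: "open U" and pos: "\<And>x. x \<in> U \<Longrightarrow> klein_factor l x > 0"
  shows "smooth_on (U \<times> - {0}) (\<lambda>(x, y). funk_metric l x y)"
  unfolding smooth_on_def
proof
  fix k
  let ?S = "U \<times> - {0 :: real^2}"
  have S: "open ?S" using U by (intro open_Times) auto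
  note C = Ck_on_add[OF S] Ck_on_diff[OF S] Ck_on_mult[OF S] Ck_on_const[OF S] Ck_on_powr[OF S]
  have "bounded_linear (\<lambda>p :: (real^2) \<times> (real^2). fst p $ i)"
    "bounded_linear (\<lambda>p :: (real^2) \<times> (real^2). snd p $ i)" for i
    by (intro bounded_linear_compose[OF bounded_linear_vec_nth] bounded_linear_fst bounded_linear_snd)+
  note coord = this[THEN Ck_on_bounded_linear[OF S]]
  have D: "Ck_on k ?S (\<lambda>p. klein_factor l (fst p))"
    unfolding klein_factor_def inner_real2 by (intro C coord)
  have Q: "Ck_on k ?S (\<lambda>p. snd p \<bullet> snd p - l\<^sup>2 * (rot90 (fst p) \<bullet> snd p)\<^sup>2)"
    unfolding rot90_inner unfolding inner_real2 power2_eq_square by (intro C coord)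
  have Q_pos: "snd p \<bullet> snd p - l\<^sup>2 * (rot90 (fst p) \<bullet> snd p)\<^sup>2 > 0" if "p \<in> ?S" for p
    using that radicand_pos[of l "fst p" "snd p"] pos by (simp add: mem_Times_iff)
  have xy: "Ck_on k ?S (\<lambda>p. fst p \<bullet> snd p)"
    unfolding inner_real2 by (intro C coord)
  have G: "Ck_on k ?S (\<lambda>p. (snd p \<bullet> snd p - l\<^sup>2 * (rot90 (fst p) \<bullet> snd p)\<^sup>2) powr (1/2) * klein_factor l (fst p) powr -1
      + l * (fst p \<bullet> snd p) * klein_factor l (fst p) powr -1)" (is "Ck_on k ?S ?G")
    by (intro D Q xy C Q_pos) (use pos in auto)
  have eq: "?G p = (case p of (x, y) \<Rightarrow> funk_metric l x y)" if "p \<in> ?S" for p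
  proof -
    have "klein_factor l (fst p) > 0" using that pos by auto
    then show ?thesis
      using Q_pos[OF that]
      by (simp add: case_prod_unfold funk_metric_eq klein_root_def powr_half_sqrt powr_minus_divide)
  qed
  show "Ck_on k ?S (\<lambda>(x, y). funk_metric l x y)"
    by (rule Ck_on_cong[OF S eq G])
qed

text \<open>Half the Hessian of \<open>F\<^sup>2\<close> is \<open>F\<^sub>y F\<^sub>y\<^sup>T + F F\<^sub>y\<^sub>y\<close>, and \<open>F\<^sub>y\<^sub>y\<close>
is the case \<open>\<sigma> = 0\<close> of \<open>has_derivative_momentum\<close>.\<close>

lemma fundamental_tensor_funk_metric:
  assumes x: "klein_factor l x > 0" and y: "y \<noteq> 0"
  shows "fundamental_tensor (funk_metric l) x y =
    (\<chi> i j. momentum l x y $ i * momentum l x y $ j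
      + funk_metric l x y / klein_root l x y ^ 3 * (rot90 y $ i * rot90 y $ j))"
proof -
  have F: "((\<lambda>z. funk_metric l x z) has_derivative (\<lambda>h. momentum l x z \<bullet> h)) (at z)" if "z \<noteq> 0" for z
    using has_derivative_funk_metric[OF has_derivative_const[of x] has_derivative_ident, of l z UNIV] x that by simp
  have p: "((\<lambda>z. momentum l x z) has_derivative
      (\<lambda>h. ((rot90 z \<bullet> h) / klein_root l x z ^ 3) *\<^sub>R rot90 z)) (at z)" if "z \<noteq> 0" for z
    using has_derivative_momentum[of "\<lambda>_. x" "\<lambda>_. 0" "\<lambda>z. z" z UNIV "\<lambda>h. h" l] x that by simp
  have grad: "partial_deriv j (\<lambda>z. (funk_metric l x z)\<^sup>2) z = 2 * funk_metric l x z * momentum l x z $ j"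
    if "z \<noteq> 0" for z j
  proof -
    have "((\<lambda>z. (funk_metric l x z)\<^sup>2) has_derivative (\<lambda>h. 2 * funk_metric l x z * (momentum l x z \<bullet> h))) (at z)"
      using has_derivative_power[OF F[OF that], of 2] by (simp add: mult_ac)
    from frechet_derivative_at[OF this, symmetric] show ?thesis
      by (simp add: partial_deriv_def inner_axis)
  qed
  have "partial_deriv i (partial_deriv j (\<lambda>z. (funk_metric l x z)\<^sup>2)) y
      = 2 * (momentum l x y $ i * momentum l x y $ j
          + funk_metric l x y / klein_root l x y ^ 3 * (rot90 y $ i * rot90 y $ j))" for i j
  proof -
    have "((\<lambda>z. 2 * funk_metric l x z * momentum l x z $ j) has_derivative
        (\<lambda>h. 2 * funk_metric l x y * ((rot90 y \<bullet> h) / klein_root l x y ^ 3 * rot90 y $ j)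
            + 2 * (momentum l x y \<bullet> h) * momentum l x y $ j)) (at y)"
      using has_derivative_mult[OF has_derivative_mult_right[OF F[OF y], of 2]
          bounded_linear.has_derivative[OF bounded_linear_vec_nth p[OF y]]] by simp
    then have "(partial_deriv j (\<lambda>z. (funk_metric l x z)\<^sup>2) has_derivative
        (\<lambda>h. 2 * funk_metric l x y * ((rot90 y \<bullet> h) / klein_root l x y ^ 3 * rot90 y $ j)
            + 2 * (momentum l x y \<bullet> h) * momentum l x y $ j)) (at y)"
      by (rule has_derivative_transform_within_open[where s = "- {0}"]) (use y grad in auto)
    from frechet_derivative_at[OF this, symmetric] show ?thesis
      by (simp add: partial_deriv_def inner_axis algebra_simps)
  qed
  then show ?thesis by (simp add: fundamental_tensor_def vec_eq_iff add_divide_distrib)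
qed

text \<open>Euler's relation for the positively homogeneous function \<open>F\<close>.\<close>

lemma momentum_inner_self:
  assumes x: "klein_factor l x > 0" and y: "y \<noteq> 0"
  shows "momentum l x y \<bullet> y = funk_metric l x y"
proof -
  have "klein_root l x y ^ 2 = y \<bullet> y - l\<^sup>2 * (rot90 x \<bullet> y)\<^sup>2"
    using radicand_pos[OF assms] by (simp add: klein_root_def)
  then have "(y - (l\<^sup>2 * (rot90 x \<bullet> y)) *\<^sub>R rot90 x) \<bullet> y = klein_root l x y * klein_root l x y"
    by (simp add: inner_diff_left power2_eq_square)
  then show ?thesis
    using klein_root_pos[OF assms] by (simp add: momentum_def funk_metric_eq inner_add_left)
qed

lemma positive_definite_fundamental_tensor:
  assumes x: "klein_factor l x > 0" and y: "y \<noteq> 0"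
  shows "positive_definite (fundamental_tensor (funk_metric l) x y)"
proof -
  let ?F = "funk_metric l x y" and ?p = "momentum l x y" and ?R = "klein_root l x y"
  have F: "?F > 0" and R: "?R > 0" using funk_metric_pos klein_root_pos assms by auto
  have quad: "v \<bullet> (fundamental_tensor (funk_metric l) x y *v v)
      = (?p \<bullet> v)\<^sup>2 + ?F / ?R ^ 3 * (rot90 y \<bullet> v)\<^sup>2" for v
    unfolding fundamental_tensor_funk_metric[OF assms]
    by (simp add: inner_real2 matrix_vector_mult_def sum_2) algebra
  have "(?p \<bullet> v)\<^sup>2 + ?F / ?R ^ 3 * (rot90 y \<bullet> v)\<^sup>2 > 0" if "v \<noteq> 0" for v
  proof (cases "rot90 y \<bullet> v = 0")
    case True
    then obtain k where k: "v = k *\<^sub>R y" using parallel_if_rot90_orthogonal[OF y] by blast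
    then have "?p \<bullet> v = k * ?F" by (simp add: momentum_inner_self[OF assms])
    moreover have "k \<noteq> 0" using k that by auto
    ultimately show ?thesis using F True by simp
  next
    case False
    then show ?thesis using F R by (intro add_nonneg_pos mult_pos_pos divide_pos_pos) auto
  qed
  moreover have "transpose (fundamental_tensor (funk_metric l) x y) = fundamental_tensor (funk_metric l) x y"
    unfolding fundamental_tensor_funk_metric[OF assms] by (simp add: transpose_def vec_eq_iff mult_ac)
  ultimately show ?thesis by (simp add: positive_definite_def quad)
qed

lemma open_funk_domain: "l \<ge> 0 \<Longrightarrow> open (funk_domain l)"
  unfolding funk_domain_eq klein_factor_def
  by (intro open_Collect_less continuous_intros)

theorem finsler_metric_funk_metric:
  assumes "l \<ge> 0"
  shows "finsler_metric (funk_domain l) (funk_metric l)"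
  unfolding finsler_metric_def
proof (intro conjI)
  show "open (funk_domain l)" by (rule open_funk_domain[OF assms])
  show "smooth_on (funk_domain l \<times> - {0}) (\<lambda>(x, y). funk_metric l x y)"
    by (rule smooth_on_funk_metric[OF open_funk_domain[OF assms]]) (simp add: funk_domain_eq assms)
qed (simp_all add: funk_domain_eq assms funk_metric_pos funk_metric_homogeneous
      positive_definite_fundamental_tensor)

section \<open>First variation of length\<close>

text \<open>Differentiation under the integral sign. The integrand is differentiable only where the varied curve
stays in the domain and remains regular; compactness of the parameter interval makes this hold for
all small \<open>s\<close> at once.\<close>

lemma finsler_length_variation:
  fixes c c' \<eta> \<eta>' :: "real \<Rightarrow> real^2"
  assumes ab: "a < b"
    and c: "\<And>t. t \<in> {a..b} \<Longrightarrow> (c has_vector_derivative c' t) (at t within {a..b})"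
    and e: "\<And>t. t \<in> {a..b} \<Longrightarrow> (\<eta> has_vector_derivative \<eta>' t) (at t within {a..b})"
    and c': "continuous_on {a..b} c'" and e': "continuous_on {a..b} \<eta>'"
    and pos: "\<And>t. t \<in> {a..b} \<Longrightarrow> klein_factor l (c t) > 0" "\<And>t. t \<in> {a..b} \<Longrightarrow> c' t \<noteq> 0"
  shows "((\<lambda>s. finsler_length (funk_metric l) a b (\<lambda>t. c t + s *\<^sub>R \<eta> t)) has_real_derivative
     integral {a..b} (\<lambda>t. force l (c t) (c' t) \<bullet> \<eta> t + momentum l (c t) (c' t) \<bullet> \<eta>' t)) (at 0)"
proof -
  have cc: "continuous_on {a..b} c" and ec: "continuous_on {a..b} \<eta>"
    by (blast intro: continuous_on_vector_derivative[OF c] continuous_on_vector_derivative[OF e])+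
  let ?x = "\<lambda>s t. c t + s *\<^sub>R \<eta> t" and ?y = "\<lambda>s t. c' t + s *\<^sub>R \<eta>' t"
  note [continuous_intros] =
    continuous_on_compose2[OF cc] continuous_on_compose2[OF ec]
    continuous_on_compose2[OF c'] continuous_on_compose2[OF e']
  \<comment> \<open>The parameters at which the varied curve lies in the domain and is regular.\<close>
  define G where "G = {a..b} \<times> (UNIV :: real set) \<inter>
    (\<lambda>(t, s). (klein_factor l (?x s t), ?y s t)) -` ({0<..} \<times> - {0})"
  have "openin (top_of_set ({a..b} \<times> UNIV)) G"
    unfolding G_def klein_factor_def
    by (intro continuous_openin_preimage_gen open_Times)
       (auto simp: case_prod_unfold intro!: continuous_intros)
  moreover have "{a..b} \<noteq> {}" "(\<lambda>t. (t, 0)) ` {a..b} \<subseteq> G"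
    using ab pos by (auto simp: G_def)
  ultimately obtain V where "openin (top_of_set UNIV) V" and V: "0 \<in> V" "{a..b} \<times> V \<subseteq> G"
    using Retracts.tube_lemma[OF compact_Icc[of a b]] by metis
  then have "open V" by simp
  then obtain \<epsilon> where \<epsilon>: "\<epsilon> > 0" "ball 0 \<epsilon> \<subseteq> V" using V(1) by (meson open_contains_ball)
  have good: "klein_factor l (?x s t) > 0" "?y s t \<noteq> 0" if "s \<in> ball 0 \<epsilon>" "t \<in> {a..b}" for s t
  proof -
    have "(t, s) \<in> G" using V(2) \<epsilon>(2) that by blast
    then show "klein_factor l (?x s t) > 0" "?y s t \<noteq> 0" by (auto simp: G_def)
  qed
  have root: "klein_root l (?x s t) (?y s t) \<noteq> 0" if "s \<in> ball 0 \<epsilon>" "t \<in> {a..b}" for s t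
    using klein_root_pos[OF good[OF that]] by simp
  have fac: "klein_factor l (?x s t) \<noteq> 0" if "s \<in> ball 0 \<epsilon>" "t \<in> {a..b}" for s t
    using good(1)[OF that] by simp
  let ?f = "\<lambda>s t. funk_metric l (?x s t) (?y s t)"
  let ?f' = "\<lambda>s t. force l (?x s t) (?y s t) \<bullet> \<eta> t + momentum l (?x s t) (?y s t) \<bullet> \<eta>' t"
  have length: "finsler_length (funk_metric l) a b (?x s) = integral (cbox a b) (?f s)" for s
  proof -
    have "vector_derivative (?x s) (at t within {a..b}) = ?y s t" if "t \<in> {a..b}" for t
      using ab that by (intro vector_derivative_within_closed_interval)
        (auto intro!: derivative_eq_intros c[OF that] e[OF that])
    then show ?thesis unfolding finsler_length_def by (auto intro!: integral_cong)
  qed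
  have "((\<lambda>s. integral (cbox a b) (?f s)) has_field_derivative integral (cbox a b) (?f' 0))
      (at 0 within ball 0 \<epsilon>)"
  proof (rule leibniz_rule_field_derivative)
    fix s t :: real assume st: "s \<in> ball 0 \<epsilon>" "t \<in> cbox a b"
    have x: "((\<lambda>s. ?x s t) has_derivative (\<lambda>h. h *\<^sub>R \<eta> t)) (at s within ball 0 \<epsilon>)"
      and y: "((\<lambda>s. ?y s t) has_derivative (\<lambda>h. h *\<^sub>R \<eta>' t)) (at s within ball 0 \<epsilon>)"
      by (auto intro!: derivative_eq_intros)
    show "((\<lambda>s. ?f s t) has_field_derivative ?f' s t) (at s within ball 0 \<epsilon>)"
      using has_derivative_funk_metric[OF x y, of l] good[of s t] st
      by (auto simp: has_field_derivative_def algebra_simps elim!: has_derivative_eq_rhs)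
  next
    fix s :: real assume s: "s \<in> ball 0 \<epsilon>"
    have "continuous_on (cbox a b) (\<lambda>t. klein_factor l (?x s t))"
      and "continuous_on (cbox a b) (\<lambda>t. klein_root l (?x s t) (?y s t))"
      unfolding klein_factor_def klein_root_def by (auto intro!: continuous_intros)
    then have "continuous_on (cbox a b) (?f s)"
      using s fac unfolding funk_metric_eq by (auto intro!: continuous_intros)
    then show "?f s integrable_on cbox a b" by (rule integrable_continuous)
  next
    have D: "continuous_on (ball 0 \<epsilon> \<times> cbox a b) (\<lambda>(s, t). klein_factor l (?x s t))"
      and R: "continuous_on (ball 0 \<epsilon> \<times> cbox a b) (\<lambda>(s, t). klein_root l (?x s t) (?y s t))"
      unfolding klein_factor_def klein_root_def case_prod_unfold
      by (auto intro!: continuous_intros)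
    show "continuous_on (ball 0 \<epsilon> \<times> cbox a b) (\<lambda>(s, t). ?f' s t)"
      using D R fac root unfolding force_def momentum_def funk_metric_eq case_prod_unfold
      by (auto intro!: continuous_intros)
  qed (use \<epsilon> in auto)
  then have "((\<lambda>s. integral (cbox a b) (?f s)) has_field_derivative integral (cbox a b) (?f' 0)) (at 0)"
    using \<epsilon>(1) by (simp add: at_within_open[of 0 "ball 0 \<epsilon>"])
  then show ?thesis unfolding length by simp
qed

lemma smooth_curve_onE:
  assumes "smooth_curve_on I c"
  obtains c' c'' where
    "\<And>t. t \<in> I \<Longrightarrow> (c has_vector_derivative c' t) (at t within I)"
    "\<And>t. t \<in> I \<Longrightarrow> (c' has_vector_derivative c'' t) (at t within I)"
    "continuous_on I c''"
proof -
  obtain d where d: "d 0 = c" "\<And>k t. t \<in> I \<Longrightarrow> (d k has_vector_derivative d (Suc k) t) (at t within I)"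
    using assms by (auto simp: smooth_curve_on_def)
  have "continuous_on I (d 2)"
    using d(2)[of _ 2] by (intro continuous_on_vector_derivative) auto
  then show ?thesis
    using that[of "d 1" "d 2"] d(1) d(2)[of _ 0] d(2)[of _ 1] by (simp add: numeral_2_eq_2)
qed

lemma smooth_curve_on_parabola:
  "smooth_curve_on S (\<lambda>t. ((t - a) * (b - t)) *\<^sub>R w)"
proof -
  define d where "d k t = (case k of 0 \<Rightarrow> (t - a) * (b - t) | Suc 0 \<Rightarrow> a + b - 2 * t
      | Suc (Suc 0) \<Rightarrow> - 2 | _ \<Rightarrow> 0) *\<^sub>R w" for k t
  have "(d k has_vector_derivative d (Suc k) t) (at t within S)" for k t
    unfolding d_def[abs_def] has_vector_derivative_def
    by (auto split: nat.split intro!: derivative_eq_intros simp: algebra_simps)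
  moreover have "d 0 = (\<lambda>t. ((t - a) * (b - t)) *\<^sub>R w)" by (simp add: d_def fun_eq_iff)
  ultimately show ?thesis unfolding smooth_curve_on_def by blast
qed

text \<open>Integration by parts: by \<open>has_derivative_momentum\<close> the force is the derivative of the momentum
up to the curvature term, and the boundary terms vanish with \<open>\<eta>\<close>.\<close>

lemma funk_first_variation:
  fixes c c' c'' \<eta> :: "real \<Rightarrow> real^2"
  assumes ab: "a < b"
    and c: "\<And>t. t \<in> {a..b} \<Longrightarrow> (c has_vector_derivative c' t) (at t within {a..b})"
    and c': "\<And>t. t \<in> {a..b} \<Longrightarrow> (c' has_vector_derivative c'' t) (at t within {a..b})"
    and c'': "continuous_on {a..b} c''"
    and pos: "\<And>t. t \<in> {a..b} \<Longrightarrow> klein_factor l (c t) > 0" "\<And>t. t \<in> {a..b} \<Longrightarrow> c' t \<noteq> 0"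
    and e: "smooth_curve_on {a..b} \<eta>" "\<eta> a = 0" "\<eta> b = 0"
  shows "((\<lambda>s. finsler_length (funk_metric l) a b (\<lambda>t. c t + s *\<^sub>R \<eta> t)) has_real_derivative
     - integral {a..b} (\<lambda>t. (rot90 (c' t) \<bullet> c'' t) / klein_root l (c t) (c' t) ^ 3 * (rot90 (c' t) \<bullet> \<eta> t))) (at 0)"
proof -
  obtain \<eta>' \<eta>'' where \<eta>': "\<And>t. t \<in> {a..b} \<Longrightarrow> (\<eta> has_vector_derivative \<eta>' t) (at t within {a..b})"
    and \<eta>'': "\<And>t. t \<in> {a..b} \<Longrightarrow> (\<eta>' has_vector_derivative \<eta>'' t) (at t within {a..b})"
    using smooth_curve_onE[OF e(1)] by metis
  have e': "continuous_on {a..b} \<eta>'" and ec: "continuous_on {a..b} \<eta>"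
    by (blast intro: continuous_on_vector_derivative[OF \<eta>''] continuous_on_vector_derivative[OF \<eta>'])+
  have cc': "continuous_on {a..b} c'" and cc: "continuous_on {a..b} c"
    by (blast intro: continuous_on_vector_derivative[OF c'] continuous_on_vector_derivative[OF c])+
  define K where "K t = (rot90 (c' t) \<bullet> c'' t) / klein_root l (c t) (c' t) ^ 3 * (rot90 (c' t) \<bullet> \<eta> t)" for t
  define A where "A t = force l (c t) (c' t) \<bullet> \<eta> t + momentum l (c t) (c' t) \<bullet> \<eta>' t" for t
  have root: "klein_root l (c t) (c' t) \<noteq> 0" if "t \<in> {a..b}" for t
    using klein_root_pos[OF pos[OF that]] by simp
  have "continuous_on {a..b} (\<lambda>t. klein_root l (c t) (c' t))"
    unfolding klein_root_def by (intro continuous_intros cc cc')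
  then have "continuous_on {a..b} K"
    unfolding K_def using root by (intro continuous_intros cc' c'' ec) auto
  then have K: "K integrable_on {a..b}" by (rule integrable_continuous_real)
  have "((\<lambda>t. momentum l (c t) (c' t) \<bullet> \<eta> t) has_vector_derivative A t + K t) (at t within {a..b})"
    if t: "t \<in> {a..b}" for t
  proof -
    have "((\<lambda>t. momentum l (c t) (c' t)) has_derivative
      (\<lambda>h. h *\<^sub>R force l (c t) (c' t)
       + ((rot90 (c' t) \<bullet> h *\<^sub>R c'' t) / klein_root l (c t) (c' t) ^ 3) *\<^sub>R rot90 (c' t))) (at t within {a..b})"
      using c[OF t] c'[OF t] pos[OF t] unfolding has_vector_derivative_def
      by (intro has_derivative_momentum) 
    from has_derivative_inner[OF this \<eta>'[OF t, unfolded has_vector_derivative_def]]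
    show ?thesis unfolding has_vector_derivative_def
      by (rule has_derivative_eq_rhs) (auto simp: A_def K_def algebra_simps inner_add_left)
  qed
  then have "((\<lambda>t. A t + K t) has_integral 0) {a..b}"
    using fundamental_theorem_of_calculus[of a b "\<lambda>t. momentum l (c t) (c' t) \<bullet> \<eta> t" "\<lambda>t. A t + K t"] ab e
    by simp
  from has_integral_diff[OF this integrable_integral[OF K]]
  have "integral {a..b} A = - integral {a..b} K" by (simp add: integral_unique)
  then show ?thesis
    using finsler_length_variation[OF ab c \<eta>' cc' e' pos] unfolding A_def K_def by simp
qed

text \<open>The point may be an endpoint of \<open>I\<close>, so the subinterval is taken on one side of it, towards another
point of \<open>I\<close>.\<close>

lemma subinterval_near:
  fixes I :: "real set"
  assumes "is_interval I" "interior I \<noteq> {}" "t \<in> I" "\<delta> > 0"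
  obtains a b where "a < b" "{a..b} \<subseteq> I" "t \<in> {a..b}" "{a..b} \<subseteq> ball t \<delta>"
proof -
  have "I \<noteq> {t}" using assms(2) by auto
  then obtain r where r: "r \<in> I" "r \<noteq> t" using assms(3) by auto
  define s where "s = (if r < t then max r (t - \<delta> / 2) else min r (t + \<delta> / 2))"
  have sub: "{min s t..max s t} \<subseteq> I"
  proof
    fix x assume x: "x \<in> {min s t..max s t}"
    show "x \<in> I"
    proof (cases "r < t")
      case True
      with x have "r \<le> x" "x \<le> t" using \<open>\<delta> > 0\<close> by (auto simp: s_def)
      then show ?thesis using mem_is_interval_1_I[OF assms(1) r(1) assms(3)] by blast
    next
      case False
      with x have "t \<le> x" "x \<le> r" using r(2) \<open>\<delta> > 0\<close> by (auto simp: s_def)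
      then show ?thesis using mem_is_interval_1_I[OF assms(1) assms(3) r(1)] by blast
    qed
  qed
  have "s \<noteq> t" "\<bar>s - t\<bar> < \<delta>" using r(2) \<open>\<delta> > 0\<close> by (auto simp: s_def)
  then show ?thesis
    by (intro that[of "min s t" "max s t"] sub) (auto simp: dist_real_def)
qed

section \<open>Geodesics are straight\<close>

text \<open>The fundamental lemma of the calculus of variations. Since a geodesic is critical on every compact
subinterval, a polynomial variation on a short interval detects the sign of the integrand.\<close>

lemma funk_geodesic_acceleration_parallel:
  fixes c c' c'' :: "real \<Rightarrow> real^2"
  assumes l: "l \<ge> 0" and geo: "finsler_geodesic (funk_domain l) (funk_metric l) I c"
    and c: "\<And>t. t \<in> I \<Longrightarrow> (c has_vector_derivative c' t) (at t within I)"
    and c': "\<And>t. t \<in> I \<Longrightarrow> (c' has_vector_derivative c'' t) (at t within I)"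
    and c'': "continuous_on I c''"
    and pos: "\<And>t. t \<in> I \<Longrightarrow> klein_factor l (c t) > 0" "\<And>t. t \<in> I \<Longrightarrow> c' t \<noteq> 0"
    and t0: "t0 \<in> I"
  shows "rot90 (c' t0) \<bullet> c'' t0 = 0"
proof (rule ccontr)
  assume nz: "rot90 (c' t0) \<bullet> c'' t0 \<noteq> 0"
  \<comment> \<open>The scalar factor makes the integrand below positive at \<open>t0\<close>, whatever the sign of the curvature.\<close>
  define w where "w = (rot90 (c' t0) \<bullet> c'' t0) *\<^sub>R rot90 (c' t0)"
  define h where "h t = (rot90 (c' t) \<bullet> c'' t) / klein_root l (c t) (c' t) ^ 3 * (rot90 (c' t) \<bullet> w)" for t
  have root: "klein_root l (c t) (c' t) > 0" if "t \<in> I" for t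
    using klein_root_pos[OF pos[OF that]] .
  have "h t0 = (rot90 (c' t0) \<bullet> c'' t0)\<^sup>2 * (rot90 (c' t0) \<bullet> rot90 (c' t0)) / klein_root l (c t0) (c' t0) ^ 3"
    by (simp add: h_def w_def power2_eq_square)
  moreover have "rot90 (c' t0) \<noteq> 0" using nz by auto
  ultimately have h0: "h t0 > 0" using root[OF t0] nz by simp
  have cc': "continuous_on I c'" and cc: "continuous_on I c"
    by (blast intro: continuous_on_vector_derivative[OF c'] continuous_on_vector_derivative[OF c])+
  have "continuous_on I (\<lambda>t. klein_root l (c t) (c' t))"
    unfolding klein_root_def by (intro continuous_intros cc cc')
  then have h: "continuous_on I h"
    unfolding h_def using root by (intro continuous_intros cc' c'') (auto simp: less_imp_neq[THEN not_sym])
  obtain \<delta> where \<delta>: "\<delta> > 0" "\<And>t. t \<in> I \<Longrightarrow> dist t t0 < \<delta> \<Longrightarrow> dist (h t) (h t0) < h t0"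
    using h t0 h0 unfolding continuous_on_iff by metis
  have I: "is_interval I" "interior I \<noteq> {}"
    using geo by (auto simp: finsler_geodesic_def)
  obtain a b where ab: "a < b" "{a..b} \<subseteq> I" "{a..b} \<subseteq> ball t0 \<delta>"
    using subinterval_near[OF I t0 \<delta>(1)] by metis
  have hpos: "h t > 0" if "t \<in> {a..b}" for t
    using \<delta>(2)[of t] ab(2,3) that by (force simp: dist_real_def dist_commute)
  define \<eta> where "\<eta> t = ((t - a) * (b - t)) *\<^sub>R w" for t
  have \<eta>: "smooth_curve_on {a..b} \<eta>" "\<eta> a = 0" "\<eta> b = 0"
    using smooth_curve_on_parabola[of _ a b w] by (auto simp: \<eta>_def[abs_def])
  let ?L = "\<lambda>s. finsler_length (funk_metric l) a b (\<lambda>t. c t + s *\<^sub>R \<eta> t)"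
  have "(?L has_real_derivative
     - integral {a..b} (\<lambda>t. (rot90 (c' t) \<bullet> c'' t) / klein_root l (c t) (c' t) ^ 3 * (rot90 (c' t) \<bullet> \<eta> t))) (at 0)"
  proof (rule funk_first_variation[OF ab(1) _ _ continuous_on_subset[OF c'' ab(2)] _ _ \<eta>])
    fix t assume "t \<in> {a..b}"
    then have t: "t \<in> I" using ab(2) by blast
    show "(c has_vector_derivative c' t) (at t within {a..b})"
      "(c' has_vector_derivative c'' t) (at t within {a..b})"
      by (rule has_vector_derivative_within_subset[OF c[OF t] ab(2)],
          rule has_vector_derivative_within_subset[OF c'[OF t] ab(2)])
    show "klein_factor l (c t) > 0" "c' t \<noteq> 0" using pos t by auto
  qed
  moreover have "(?L has_real_derivative 0) (at 0)"
    using geo ab \<eta> by (simp add: finsler_geodesic_def)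
  ultimately have "integral {a..b} (\<lambda>t. (t - a) * (b - t) * h t) = 0"
    using DERIV_unique by (fastforce simp: \<eta>_def h_def mult_ac)
  moreover have "continuous_on {a..b} (\<lambda>t. (t - a) * (b - t) * h t)"
    by (intro continuous_intros continuous_on_subset[OF h] ab)
  moreover have "(t - a) * (b - t) * h t \<ge> 0" if "t \<in> {a..b}" for t
    using that hpos[OF that] by simp
  ultimately have "\<forall>t\<in>{a..b}. (t - a) * (b - t) * h t = 0"
    using ab(1) integral_eq_0_iff by blast
  moreover have m: "(a + b) / 2 \<in> {a..b}" using ab(1) by simp
  ultimately have "((a + b) / 2 - a) * (b - (a + b) / 2) * h ((a + b) / 2) = 0" by blast
  moreover have "((a + b) / 2 - a) * (b - (a + b) / 2) * h ((a + b) / 2) > 0"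
    using ab(1) hpos[OF m] by (intro mult_pos_pos) (auto simp: field_simps)
  ultimately show False by (metis less_irrefl)
qed

text \<open>The unit tangent is the momentum of the Euclidean metric, so \<open>has_derivative_momentum\<close> for
\<open>l = 0\<close> shows that it is constant. Its product with \<open>c\<close> after rotation by a right angle is
then constant as well, which is the equation of a line.\<close>

lemma straight_if_acceleration_parallel:
  fixes c c' c'' :: "real \<Rightarrow> real^2"
  assumes I: "convex I"
    and c: "\<And>t. t \<in> I \<Longrightarrow> (c has_vector_derivative c' t) (at t within I)"
    and c': "\<And>t. t \<in> I \<Longrightarrow> (c' has_vector_derivative c'' t) (at t within I)"
    and reg: "\<And>t. t \<in> I \<Longrightarrow> c' t \<noteq> 0" and par: "\<And>t. t \<in> I \<Longrightarrow> rot90 (c' t) \<bullet> c'' t = 0"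
  shows "\<exists>L. straight_line L \<and> c ` I \<subseteq> L"
proof (cases "I = {}")
  case True
  have "straight_line {0 + s *\<^sub>R (axis 1 1 :: real^2) | s. True}"
    unfolding straight_line_def
    by (rule exI[of _ 0], rule exI[of _ "axis 1 1"]) (simp add: axis_eq_0_iff)
  then show ?thesis using True by blast
next
  case False
  then obtain t0 where t0: "t0 \<in> I" by blast
  have flat: "klein_factor 0 x > 0" for x by (simp add: klein_factor_def)
  have "((\<lambda>t. momentum 0 (c t) (c' t)) has_derivative (\<lambda>h. 0)) (at t within I)" if t: "t \<in> I" for t
  proof -
    have "((\<lambda>t. momentum 0 (c t) (c' t)) has_derivative
      (\<lambda>h. h *\<^sub>R force 0 (c t) (c' t)
       + ((rot90 (c' t) \<bullet> h *\<^sub>R c'' t) / klein_root 0 (c t) (c' t) ^ 3) *\<^sub>R rot90 (c' t))) (at t within I)"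
      using c[OF t] c'[OF t] reg[OF t] flat unfolding has_vector_derivative_def
      by (intro has_derivative_momentum)
    then show ?thesis by (simp add: par[OF t] force_def)
  qed
  from has_derivative_zero_constant[OF I this]
  obtain u where "\<forall>t\<in>I. momentum 0 (c t) (c' t) = u" by blast
  then have u: "(1 / klein_root 0 (c t) (c' t)) *\<^sub>R c' t = u" if "t \<in> I" for t
    using that by (simp add: momentum_def klein_factor_def)
  have u0: "u \<noteq> 0"
    using u[OF t0] reg[OF t0] klein_root_pos[OF flat reg[OF t0], of "c t0"] by auto
  have ortho: "rot90 u \<bullet> c' t = 0" if "t \<in> I" for t
    using u[OF that] by (auto simp: inner_real2)
  have "((\<lambda>t. rot90 u \<bullet> c t) has_derivative (\<lambda>h. 0)) (at t within I)" if "t \<in> I" for t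
    using has_derivative_inner_right[OF c[OF that, unfolded has_vector_derivative_def], of "rot90 u"] ortho[OF that]
    by simp
  from has_derivative_zero_constant[OF I this]
  have "rot90 u \<bullet> (c t - c t0) = 0" if "t \<in> I" for t
    using that t0 by (metis inner_diff_right diff_self)
  then have "c t - c t0 = ((u \<bullet> (c t - c t0)) / (u \<bullet> u)) *\<^sub>R u" if "t \<in> I" for t
    using that u0 parallel_if_rot90_orthogonal by blast
  then have "c t = c t0 + ((u \<bullet> (c t - c t0)) / (u \<bullet> u)) *\<^sub>R u" if "t \<in> I" for t
    using that by (metis add.commute diff_add_cancel)
  then have "c ` I \<subseteq> {c t0 + s *\<^sub>R u | s. True}" by blast
  then show ?thesis using u0 unfolding straight_line_def by blast
qed
theorem theorem3:
  fixes l :: real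
  assumes "l \<ge> 0"
  shows "projectively_flat (funk_domain l) (funk_metric l)"
  unfolding projectively_flat_def
proof (intro conjI allI impI)
  show "finsler_metric (funk_domain l) (funk_metric l)"
    by (rule finsler_metric_funk_metric[OF assms])
next
  fix I c assume geo: "finsler_geodesic (funk_domain l) (funk_metric l) I c"
  then have I: "is_interval I" and smooth: "smooth_curve_on I c" and U: "c ` I \<subseteq> funk_domain l"
    and reg: "\<And>t. t \<in> I \<Longrightarrow> vector_derivative c (at t within I) \<noteq> 0"
    by (auto simp: finsler_geodesic_def)
  obtain c' c'' where c': "\<And>t. t \<in> I \<Longrightarrow> (c has_vector_derivative c' t) (at t within I)"
    and c'': "\<And>t. t \<in> I \<Longrightarrow> (c' has_vector_derivative c'' t) (at t within I)"
    and cont: "continuous_on I c''"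
    using smooth_curve_onE[OF smooth] by metis
  have pos: "klein_factor l (c t) > 0" if "t \<in> I" for t
    using U that by (auto simp: funk_domain_eq[OF assms])
  \<comment> \<open>The derivative \<open>c'\<close> agrees with \<open>vector_derivative\<close> only if no point of \<open>I\<close> is isolated.\<close>
  have "interior I \<noteq> {}" using geo by (simp add: finsler_geodesic_def)
  have "at t within I \<noteq> bot" if t: "t \<in> I" for t
  proof -
    obtain a b where ab: "a < b" "{a..b} \<subseteq> I" "t \<in> {a..b}"
      using subinterval_near[OF I \<open>interior I \<noteq> {}\<close> t zero_less_one] by metis
    then have "t islimpt {a..b}" by (simp add: islimpt_Icc)
    then show ?thesis using islimpt_subset[OF _ ab(2)] by (simp add: trivial_limit_within)
  qed
  then have nz: "c' t \<noteq> 0" if "t \<in> I" for t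
    using reg[OF that] vector_derivative_within[OF _ c'[OF that]] that by auto
  have "rot90 (c' t) \<bullet> c'' t = 0" if "t \<in> I" for t
    by (rule funk_geodesic_acceleration_parallel[OF assms geo c' c'' cont pos nz that])
  then show "\<exists>L. straight_line L \<and> c ` I \<subseteq> L"
    using straight_if_acceleration_parallel[OF is_interval_convex[OF I] c' c'' nz] by blast
qed

end
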